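(* Let $P_1$ and $P_2$ be Markov kernels on finite state spaces $S_1,S_2$ (each with at least two elements) with stationary distributions $\pi_1,\pi_2$ of full support, respectively, and consider the product chain $P=P_1\otimes P_2$ on $S_1\times S_2$ with $\pi=\pi_1\otimes\pi_2$. Then: 1. $M_P\le\max(M_1,M_2)$. 2. If $\pi_1,\pi_2$ are uniform on $n_1,n_2$ states respectively, then $$\bar r_P=\frac{\bar r_1\log n_1+\bar r_2\log n_2}{\log(n_1n_2)}.$$ 3. If $P_1=P_2$ with uniform stationary distribution $\pi_1=\pi_2$, then $\bar r_P=\bar r_1$ and $L(P)\ge L(P_1)$.
   Context: All logarithms are natural, with $0\log0=0$. $D_{\mathrm{KL}}(\mu\|\nu)=\sum_{x}\mu(x)\log\frac{\mu(x)}{\nu(x)}$. For a Markov kernel $Q$ on a finite set with full-support stationary distribution $\rho$: the retention profile is $r_Q(x):=D_{\mathrm{KL}}(Q(x,\cdot)\|\rho)/\log(1/\rho(x))$, $M_Q:=\max_x r_Q(x)$, $\bar r_Q:=\sum_x\rho(x)r_Q(x)$, and the localization ratio is $L(Q):=\bar r_Q/M_Q$, with the convention $L(Q)=1$ when $\bar r_Q=M_Q=0$. Subscripts $1,2,P$ refer to $P_1$ (with $\pi_1$), $P_2$ (with $\pi_2$), $P$ (with $\pi$). The product kernel is $(P_1\otimes P_2)((x_1,x_2),(y_1,y_2))=P_1(x_1,y_1)P_2(x_2,y_2)$ and $(\pi_1\otimes\pi_2)(x_1,x_2)=\pi_1(x_1)\pi_2(x_2)$. *)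

theory Defs
  imports "HOL-Probability.Probability"
begin

text \<open>
  A Markov kernel on a finite state space is a map \<open>'a::finite \<Rightarrow> 'a pmf\<close>; the row
  \<open>Q(x, \<cdot>)\<close> is the distribution \<open>Q x\<close>. Irreducibility is not assumed, so a stationary
  distribution need not be unique and is carried along as an explicit argument \<open>\<rho>\<close>.
\<close>

definition stationary :: "('a::finite \<Rightarrow> 'a pmf) \<Rightarrow> 'a pmf \<Rightarrow> bool" where
  "stationary Q \<rho> \<longleftrightarrow> (\<forall>y. (\<Sum>x\<in>UNIV. pmf \<rho> x * pmf (Q x) y) = pmf \<rho> y)"

definition full_support :: "'a pmf \<Rightarrow> bool" where
  "full_support \<rho> \<longleftrightarrow> (\<forall>x. pmf \<rho> x > 0)"

definition product_kernel ::
  "('a \<Rightarrow> 'a pmf) \<Rightarrow> ('b \<Rightarrow> 'b pmf) \<Rightarrow> 'a \<times> 'b \<Rightarrow> ('a \<times> 'b) pmf" where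
  "product_kernel P1 P2 = (\<lambda>(x1, x2). pair_pmf (P1 x1) (P2 x2))"

text \<open>
  Terms with \<open>\<mu>(x) = 0\<close> vanish because of the factor \<open>pmf \<mu> x\<close>. The formula is only
  meaningful when \<open>\<nu>(x) = 0\<close> implies \<open>\<mu>(x) = 0\<close>; below, \<open>\<nu>\<close> always has full support.
\<close>

definition D_KL :: "'a::finite pmf \<Rightarrow> 'a pmf \<Rightarrow> real" where
  "D_KL \<mu> \<nu> = (\<Sum>x\<in>UNIV. pmf \<mu> x * ln (pmf \<mu> x / pmf \<nu> x))"

definition retention :: "('a::finite \<Rightarrow> 'a pmf) \<Rightarrow> 'a pmf \<Rightarrow> 'a \<Rightarrow> real" where
  "retention Q \<rho> x = D_KL (Q x) \<rho> / ln (1 / pmf \<rho> x)"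

definition max_retention :: "('a::finite \<Rightarrow> 'a pmf) \<Rightarrow> 'a pmf \<Rightarrow> real" where
  "max_retention Q \<rho> = (MAX x. retention Q \<rho> x)"

definition mean_retention :: "('a::finite \<Rightarrow> 'a pmf) \<Rightarrow> 'a pmf \<Rightarrow> real" where
  "mean_retention Q \<rho> = (\<Sum>x\<in>UNIV. pmf \<rho> x * retention Q \<rho> x)"

definition localization_ratio :: "('a::finite \<Rightarrow> 'a pmf) \<Rightarrow> 'a pmf \<Rightarrow> real" where
  "localization_ratio Q \<rho> =
     (if mean_retention Q \<rho> = 0 \<and> max_retention Q \<rho> = 0 then 1
      else mean_retention Q \<rho> / max_retention Q \<rho>)"

lemma pmf_product_kernel:
  "pmf (product_kernel P1 P2 (x1, x2)) (y1, y2) = pmf (P1 x1) y1 * pmf (P2 x2) y2"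
  by (simp add: product_kernel_def pmf_pair)

lemma stationary_product_kernel:
  fixes P1 :: "'a::finite \<Rightarrow> 'a pmf" and P2 :: "'b::finite \<Rightarrow> 'b pmf"
  assumes "stationary P1 \<pi>1" "stationary P2 \<pi>2"
  shows "stationary (product_kernel P1 P2) (pair_pmf \<pi>1 \<pi>2)"
  unfolding stationary_def
proof
  fix y :: "'a \<times> 'b"
  obtain y1 y2 where y: "y = (y1, y2)" by (cases y)
  have "(\<Sum>x\<in>UNIV. pmf (pair_pmf \<pi>1 \<pi>2) x * pmf (product_kernel P1 P2 x) y)
      = (\<Sum>x1\<in>UNIV. \<Sum>x2\<in>UNIV. (pmf \<pi>1 x1 * pmf (P1 x1) y1) * (pmf \<pi>2 x2 * pmf (P2 x2) y2))"
    unfolding UNIV_Times_UNIV[symmetric] y sum.cartesian_product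
    by (auto intro!: sum.cong simp: pmf_pair pmf_product_kernel)
  also have "\<dots> = pmf \<pi>1 y1 * pmf \<pi>2 y2"
    using assms by (simp add: stationary_def flip: sum_product)
  finally show "(\<Sum>x\<in>UNIV. pmf (pair_pmf \<pi>1 \<pi>2) x * pmf (product_kernel P1 P2 x) y)
      = pmf (pair_pmf \<pi>1 \<pi>2) y"
    by (simp add: y pmf_pair)
qed

lemma full_support_pair_pmf:
  "full_support \<pi>1 \<Longrightarrow> full_support \<pi>2 \<Longrightarrow> full_support (pair_pmf \<pi>1 \<pi>2)"
  by (auto simp: full_support_def pmf_pair)

end

theory Submission imports Defs begin

text \<open>
  Relative entropy is additive over independent components, and so is the surprisal
  \<open>ln (1 / \<pi>(x))\<close>. Hence the retention of the product chain at \<open>(x1, x2)\<close> is the average of the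
  retentions at \<open>x1\<close> and \<open>x2\<close>, weighted by the surprisals. This bounds the maximum; in the
  uniform case the weights do not depend on the state, so the average passes to the mean. In the
  last part \<open>0 \<le> mean \<le> max\<close> (Gibbs' inequality), and the mean is kept while the maximum
  does not grow.
\<close>

lemma sum_pmf_UNIV: "(\<Sum>x\<in>UNIV. pmf p (x::'a::finite)) = 1"
  by (simp add: sum_pmf_eq_1)

lemma sum_UNIV_prod:
  "(\<Sum>x\<in>UNIV. f x) = (\<Sum>a\<in>UNIV. \<Sum>b\<in>UNIV. f (a::'a::finite, b::'b::finite))"
  by (simp add: sum.cartesian_product flip: UNIV_Times_UNIV)

lemma full_support_pmf_pos: "full_support p \<Longrightarrow> 0 < pmf p x"
  by (simp add: full_support_def)

text \<open>Taking t = \<nu>(x) / \<mu>(x) in ln t \<le> t - 1 bounds each summand below by \<mu>(x)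
  - \<nu>(x), and these differences sum to 1 - 1 = 0.\<close>

lemma D_KL_nonneg:
  assumes "full_support \<nu>"
  shows "0 \<le> D_KL \<mu> \<nu>"
proof -
  have "pmf \<mu> x - pmf \<nu> x \<le> pmf \<mu> x * ln (pmf \<mu> x / pmf \<nu> x)" for x
  proof (cases "pmf \<mu> x = 0")
    case False
    then have pos: "0 < pmf \<mu> x" "0 < pmf \<nu> x"
      using assms by (simp_all add: full_support_pmf_pos pmf_pos)
    have "1 - pmf \<nu> x / pmf \<mu> x \<le> - ln (pmf \<nu> x / pmf \<mu> x)"
      using ln_le_minus_one[of "pmf \<nu> x / pmf \<mu> x"] pos by simp
    also have "\<dots> = ln (pmf \<mu> x / pmf \<nu> x)"
      using pos by (simp add: ln_div)
    finally show ?thesis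
      using mult_left_mono[of _ _ "pmf \<mu> x"] pos by (fastforce simp: field_simps)
  qed simp
  then have "(\<Sum>x\<in>UNIV. pmf \<mu> x - pmf \<nu> x) \<le> D_KL \<mu> \<nu>"
    unfolding D_KL_def by (rule sum_mono)
  then show ?thesis
    by (simp add: sum_subtractf sum_pmf_UNIV)
qed

lemma D_KL_pair_pmf:
  assumes "full_support \<nu>1" "full_support \<nu>2"
  shows "D_KL (pair_pmf \<mu>1 \<mu>2) (pair_pmf \<nu>1 \<nu>2) = D_KL \<mu>1 \<nu>1 + D_KL \<mu>2 \<nu>2"
proof -
  have "pmf \<mu>1 a * pmf \<mu>2 b * ln (pmf \<mu>1 a * pmf \<mu>2 b / (pmf \<nu>1 a * pmf \<nu>2 b))
      = pmf \<mu>1 a * ln (pmf \<mu>1 a / pmf \<nu>1 a) * pmf \<mu>2 b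
        + pmf \<mu>1 a * (pmf \<mu>2 b * ln (pmf \<mu>2 b / pmf \<nu>2 b))" for a b
  \<comment> \<open>The logarithm splits only when all four masses are positive; if a factor of the
    weight vanishes, both sides are 0. In each summand of the split, the component outside the
    logarithm later sums to 1.\<close>
  proof (cases "pmf \<mu>1 a = 0 \<or> pmf \<mu>2 b = 0")
    case False
    then have "0 < pmf \<mu>1 a" "0 < pmf \<mu>2 b" "0 < pmf \<nu>1 a" "0 < pmf \<nu>2 b"
      using assms by (auto simp add: full_support_pmf_pos pmf_pos)
    then show ?thesis
      by (simp add: ln_div ln_mult algebra_simps)
  qed auto
  then have "D_KL (pair_pmf \<mu>1 \<mu>2) (pair_pmf \<nu>1 \<nu>2)
      = (\<Sum>a\<in>UNIV. \<Sum>b\<in>UNIV. pmf \<mu>1 a * ln (pmf \<mu>1 a / pmf \<nu>1 a) * pmf \<mu>2 b)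
        + (\<Sum>a\<in>UNIV. \<Sum>b\<in>UNIV. pmf \<mu>1 a * (pmf \<mu>2 b * ln (pmf \<mu>2 b / pmf \<nu>2 b)))"
    by (simp add: D_KL_def sum_UNIV_prod pmf_pair sum.distrib)
  also have "\<dots> = D_KL \<mu>1 \<nu>1 + D_KL \<mu>2 \<nu>2"
    by (simp add: D_KL_def sum_pmf_UNIV flip: sum_product)
  finally show ?thesis .
qed

text \<open>A second state has positive mass, so no state has mass 1. This lets the denominator of
  \<open>retention\<close> be cleared.\<close>

lemma surprisal_pos:
  fixes \<rho> :: "'a::finite pmf"
  assumes "2 \<le> CARD('a)" "full_support \<rho>"
  shows "0 < ln (1 / pmf \<rho> x)"
proof -
  obtain y where y: "y \<noteq> x"
    using assms(1) by (metis One_nat_def UNIV_eq_I card.empty card.insert empty_iff finite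
        insertI1 not_less_eq_eq numeral_2_eq_2 order_refl singletonI)
  have "pmf \<rho> x + pmf \<rho> y \<le> (\<Sum>z\<in>UNIV. pmf \<rho> z)"
    using sum_mono2[of UNIV "{x, y}" "pmf \<rho>"] y by simp
  then show ?thesis
    using full_support_pmf_pos[OF assms(2), of x] full_support_pmf_pos[OF assms(2), of y]
    by (simp add: sum_pmf_UNIV)
qed

lemma retention_nonneg:
  assumes "full_support \<rho>"
  shows "0 \<le> retention Q \<rho> x"
  using assms unfolding retention_def
  \<comment> \<open>A denominator that is merely nonnegative suffices, since division by 0 yields
    0.\<close>
  by (intro divide_nonneg_nonneg D_KL_nonneg) (simp_all add: full_support_pmf_pos pmf_le_1)

lemma retention_le_max: "retention Q \<rho> x \<le> max_retention Q \<rho>"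
  by (simp add: max_retention_def)

lemma mean_retention_nonneg: "full_support \<rho> \<Longrightarrow> 0 \<le> mean_retention Q \<rho>"
  unfolding mean_retention_def by (intro sum_nonneg mult_nonneg_nonneg retention_nonneg) auto

lemma mean_retention_le_max: "mean_retention Q \<rho> \<le> max_retention Q \<rho>"
proof -
  have "mean_retention Q \<rho> \<le> (\<Sum>x\<in>UNIV. pmf \<rho> x * max_retention Q \<rho>)"
    unfolding mean_retention_def by (intro sum_mono mult_left_mono retention_le_max) simp
  then show ?thesis
    by (simp add: sum_pmf_UNIV flip: sum_distrib_right)
qed

lemma max_retention_product_le:
  fixes P1 :: "'a::finite \<Rightarrow> 'a pmf" and P2 :: "'b::finite \<Rightarrow> 'b pmf"
  assumes "2 \<le> CARD('a)" "2 \<le> CARD('b)" "full_support \<pi>1" "full_support \<pi>2"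
  shows "max_retention (product_kernel P1 P2) (pair_pmf \<pi>1 \<pi>2)
    \<le> max (max_retention P1 \<pi>1) (max_retention P2 \<pi>2)" (is "_ \<le> ?M")
proof -
  have "retention (product_kernel P1 P2) (pair_pmf \<pi>1 \<pi>2) (a, b) \<le> ?M" for a b
  proof -
    have pos: "0 < ln (1 / pmf \<pi>1 a)" "0 < ln (1 / pmf \<pi>2 b)"
      using assms by (simp_all only: surprisal_pos)
    have "retention P1 \<pi>1 a \<le> ?M" "retention P2 \<pi>2 b \<le> ?M"
      by (simp_all add: retention_le_max le_max_iff_disj)
    \<comment> \<open>With denominators cleared, the two bounds can be added; dividing by the total
      surprisal then bounds the product's retention by \<open>?M\<close>.\<close>
    then have "D_KL (P1 a) \<pi>1 \<le> ?M * ln (1 / pmf \<pi>1 a)" "D_KL (P2 b) \<pi>2 \<le> ?M * ln (1 / pmf \<pi>2 b)"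
      using pos unfolding retention_def by (simp_all only: pos_divide_le_eq)
    moreover have "ln (1 / (pmf \<pi>1 a * pmf \<pi>2 b)) = ln (1 / pmf \<pi>1 a) + ln (1 / pmf \<pi>2 b)"
      using assms by (simp add: ln_mult ln_div full_support_pmf_pos less_imp_neq[symmetric])
    ultimately show ?thesis
      using pos assms unfolding retention_def
      by (simp add: product_kernel_def D_KL_pair_pmf pmf_pair pos_divide_le_eq ring_distribs
          del: ln_div ln_inverse)
  qed
  then show ?thesis
    unfolding max_retention_def[of "product_kernel P1 P2"] by auto
qed

text \<open>Every state has the same surprisal ln n, which factors out of the mean.\<close>

lemma mean_retention_uniform:
  fixes Q :: "'a::finite \<Rightarrow> 'a pmf"
  defines "u \<equiv> pmf_of_set UNIV"
  shows "mean_retention Q u = (\<Sum>x\<in>UNIV. pmf u x * D_KL (Q x) u) / ln CARD('a)"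
  by (simp add: u_def mean_retention_def retention_def sum_divide_distrib)

text \<open>Each relative entropy depends on one coordinate only, so averaging over the other
  coordinate contributes a factor 1.\<close>

lemma mean_D_KL_product:
  assumes "full_support \<pi>1" "full_support \<pi>2"
  shows "(\<Sum>x\<in>UNIV. pmf (pair_pmf \<pi>1 \<pi>2) x * D_KL (product_kernel P1 P2 x) (pair_pmf \<pi>1 \<pi>2))
    = (\<Sum>a\<in>UNIV. pmf \<pi>1 a * D_KL (P1 a) \<pi>1) + (\<Sum>b\<in>UNIV. pmf \<pi>2 b * D_KL (P2 b) \<pi>2)"
    (is "?lhs = _")
proof -
  have "?lhs = (\<Sum>a\<in>UNIV. \<Sum>b\<in>UNIV. (pmf \<pi>1 a * D_KL (P1 a) \<pi>1) * pmf \<pi>2 b)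
      + (\<Sum>a\<in>UNIV. \<Sum>b\<in>UNIV. pmf \<pi>1 a * (pmf \<pi>2 b * D_KL (P2 b) \<pi>2))"
    using assms
    by (simp add: sum_UNIV_prod pmf_pair product_kernel_def D_KL_pair_pmf algebra_simps sum.distrib)
  then show ?thesis
    by (simp add: sum_pmf_UNIV flip: sum_product)
qed

lemma pair_pmf_uniform:
  "pair_pmf (pmf_of_set UNIV) (pmf_of_set UNIV) = pmf_of_set (UNIV :: ('a::finite \<times> 'b::finite) set)"
  by (rule pmf_eqI) (auto simp: pmf_pair simp flip: UNIV_Times_UNIV)

lemma mean_retention_product_uniform:
  fixes P1 :: "'a::finite \<Rightarrow> 'a pmf" and P2 :: "'b::finite \<Rightarrow> 'b pmf"
  assumes "2 \<le> CARD('a)" "2 \<le> CARD('b)"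
  shows "mean_retention (product_kernel P1 P2) (pair_pmf (pmf_of_set UNIV) (pmf_of_set UNIV))
    = (mean_retention P1 (pmf_of_set UNIV) * ln (real CARD('a))
        + mean_retention P2 (pmf_of_set UNIV) * ln (real CARD('b)))
      / ln (real (CARD('a) * CARD('b)))"
proof -
  have "full_support (pmf_of_set (UNIV :: 'a set))" "full_support (pmf_of_set (UNIV :: 'b set))"
    by (simp_all add: full_support_def card_gt_0_iff)
  from mean_D_KL_product[OF this, of P1 P2] show ?thesis
    \<comment> \<open>Since both logarithms are nonzero, each mean retention times its logarithm is
      the mean relative entropy of that factor.\<close>
    using assms by (simp add: mean_retention_uniform pair_pmf_uniform)
qed

theorem corollaryE2:
  fixes P1 :: "'a::finite \<Rightarrow> 'a pmf" and \<pi>1 :: "'a pmf"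
    and P2 :: "'b::finite \<Rightarrow> 'b pmf" and \<pi>2 :: "'b pmf"
  assumes "CARD('a) \<ge> 2" and "CARD('b) \<ge> 2"
    and "stationary P1 \<pi>1" and "full_support \<pi>1"
    and "stationary P2 \<pi>2" and "full_support \<pi>2"
  shows "max_retention (product_kernel P1 P2) (pair_pmf \<pi>1 \<pi>2)
           \<le> max (max_retention P1 \<pi>1) (max_retention P2 \<pi>2)
    \<and> (\<pi>1 = pmf_of_set UNIV \<and> \<pi>2 = pmf_of_set UNIV \<longrightarrow>
         mean_retention (product_kernel P1 P2) (pair_pmf \<pi>1 \<pi>2)
           = (mean_retention P1 \<pi>1 * ln (real CARD('a)) + mean_retention P2 \<pi>2 * ln (real CARD('b)))
               / ln (real (CARD('a) * CARD('b))))
    \<and> (\<pi>1 = pmf_of_set UNIV \<longrightarrow>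
         mean_retention (product_kernel P1 P1) (pair_pmf \<pi>1 \<pi>1) = mean_retention P1 \<pi>1 \<and>
         localization_ratio (product_kernel P1 P1) (pair_pmf \<pi>1 \<pi>1) \<ge> localization_ratio P1 \<pi>1)"
proof (intro conjI impI)
  show "max_retention (product_kernel P1 P2) (pair_pmf \<pi>1 \<pi>2)
      \<le> max (max_retention P1 \<pi>1) (max_retention P2 \<pi>2)"
    using assms by (intro max_retention_product_le)
next
  assume "\<pi>1 = pmf_of_set UNIV \<and> \<pi>2 = pmf_of_set UNIV"
  then show "mean_retention (product_kernel P1 P2) (pair_pmf \<pi>1 \<pi>2)
      = (mean_retention P1 \<pi>1 * ln (real CARD('a)) + mean_retention P2 \<pi>2 * ln (real CARD('b)))
        / ln (real (CARD('a) * CARD('b)))"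
    using assms(1,2) by (simp only: mean_retention_product_uniform)
next
  let ?P = "product_kernel P1 P1" and ?\<pi> = "pair_pmf \<pi>1 \<pi>1"
  assume u: "\<pi>1 = pmf_of_set UNIV"
  have "0 < ln (real CARD('a))"
    using assms(1) by simp
  then show mean: "mean_retention ?P ?\<pi> = mean_retention P1 \<pi>1"
    \<comment> \<open>For equal factors the denominator ln (n * n) = 2 ln n cancels the doubled
      numerator.\<close>
    using assms(1) u mean_retention_product_uniform[of P1 P1] by (simp add: ln_mult field_simps)
  have "max_retention ?P ?\<pi> \<le> max_retention P1 \<pi>1"
    using max_retention_product_le[of \<pi>1 \<pi>1 P1 P1] assms by simp
  moreover have "0 \<le> mean_retention P1 \<pi>1"
    using assms by (intro mean_retention_nonneg)
  \<comment> \<open>If the mean is positive, this makes the product's maximum positive, so shrinking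
    the denominator raises the ratio. If the mean and the maximum of \<open>P1\<close> are both 0,
    it forces the product's maximum to be 0 too, and both ratios are 1 by convention.\<close>
  moreover have "mean_retention P1 \<pi>1 \<le> max_retention ?P ?\<pi>"
    using mean_retention_le_max[of ?P ?\<pi>] mean by simp
  ultimately show "localization_ratio ?P ?\<pi> \<ge> localization_ratio P1 \<pi>1"
    unfolding localization_ratio_def mean by (auto intro!: divide_left_mono mult_pos_pos)
qed

end
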